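(* Let $q\ge 3$ be odd and let $\mathbf f\in A_q^+$ be a forbidden factor whose last symbol is $0$. Then $\mathbf f$ does not induce zero periodicity on $A_q^\infty$ if and only if $\mathbf f\in V$.
   Context: $A_q=\{0,1,\dots,q-1\}$. $A_q^*$ (resp. $A_q^+$) is the set of all (resp. nonempty) finite words over $A_q$, $\epsilon$ the empty word, $A_q^\infty$ the set of right-infinite words. For a word $\mathbf a$, $\mathbf a^i$ is $i$-fold concatenation, $\mathbf a^\infty=\mathbf a\mathbf a\cdots$, $\mathbf a^{-\infty}=\cdots\mathbf a\mathbf a$ (left-infinite); a suffix of a left-infinite word is a finite (possibly empty) word with which it ends. For a set $X$ of words, $X(\mathbf f)$ is the set of words of $X$ not containing $\mathbf f$ as a factor (contiguous subword), and $\mathbf p|X$ the words of $X$ with prefix $\mathbf p$. An infinite word has ultimate period $\mathbf c\neq\epsilon$ if it equals $\mathbf b\mathbf c^\infty$ for a finite $\mathbf b$. Dual Reflected Gray Code order: for distinct words $\mathbf s,\mathbf t$ of the same (finite or infinite) length, with $k$ the leftmost differing position, $u=\sum_{i<k}s_i$ and $v$ the number of nonzero symbols among $s_1,\dots,s_{k-1}$, $\mathbf s\triangleleft\mathbf t$ iff ($u+v$ even and $s_k<t_k$) or ($u+v$ odd and $s_k>t_k$). For odd $q$ "first"/"last" mean least/greatest in $\triangleleft$. A factor $\mathbf f$ induces zero periodicity on $A_q^\infty$ (q odd) if for every $\mathbf p\in A_q^*(\mathbf f)$ the $\triangleleft$-first and $\triangleleft$-last words of $\mathbf p|A_q^\infty(\mathbf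 f)$ both have ultimate period $0$. $V=\bigcup_{m\ge0}\{\mathbf b0:\mathbf b\text{ a suffix of }(10^m)^{-\infty}\}$. *)

theory Defs
  imports Main "HOL-Library.Stream" "HOL-Library.Sublist"
begin

definition alphabet :: "nat \<Rightarrow> nat set" where
  "alphabet q = {..<q}"

definition stream_factor :: "'a list \<Rightarrow> 'a stream \<Rightarrow> bool" where
  "stream_factor f w \<longleftrightarrow> (\<exists>b w'. w = b @- f @- w')"

definition fin_words_avoiding :: "nat \<Rightarrow> nat list \<Rightarrow> nat list set" where
  "fin_words_avoiding q f = {p \<in> lists (alphabet q). \<not> sublist f p}"

definition inf_words_avoiding :: "nat \<Rightarrow> nat list \<Rightarrow> nat stream set" where
  "inf_words_avoiding q f = {w \<in> streams (alphabet q). \<not> stream_factor f w}"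

definition with_prefix :: "'a list \<Rightarrow> 'a stream set \<Rightarrow> 'a stream set" where
  "with_prefix p X = {w \<in> X. \<exists>w'. w = p @- w'}"

text \<open>Dual Reflected Gray Code order on infinite words: \<open>k\<close> is the leftmost position
  (counted from 0) at which the two words differ.\<close>

definition gray_less :: "nat stream \<Rightarrow> nat stream \<Rightarrow> bool" (infix "\<lhd>\<^sub>G" 50) where
  "s \<lhd>\<^sub>G t \<longleftrightarrow>
    (\<exists>k. (\<forall>i<k. s !! i = t !! i) \<and> s !! k \<noteq> t !! k \<and>
      (let u = (\<Sum>i<k. s !! i); v = card {i. i < k \<and> s !! i \<noteq> 0}
       in (even (u + v) \<and> s !! k < t !! k) \<or> (odd (u + v) \<and> s !! k > t !! k)))"

definition is_first :: "nat stream set \<Rightarrow> nat stream \<Rightarrow> bool" where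
  "is_first X w \<longleftrightarrow> w \<in> X \<and> (\<forall>x\<in>X. x \<noteq> w \<longrightarrow> w \<lhd>\<^sub>G x)"

definition is_last :: "nat stream set \<Rightarrow> nat stream \<Rightarrow> bool" where
  "is_last X w \<longleftrightarrow> w \<in> X \<and> (\<forall>x\<in>X. x \<noteq> w \<longrightarrow> x \<lhd>\<^sub>G w)"

definition has_ultimate_period :: "'a stream \<Rightarrow> 'a list \<Rightarrow> bool" where
  "has_ultimate_period w c \<longleftrightarrow> c \<noteq> [] \<and> (\<exists>b. w = b @- cycle c)"

text \<open>The definition below is the one for odd \<open>q\<close>; for even \<open>q\<close> the notions of first and last
  word are different.\<close>

definition induces_zero_periodicity :: "nat \<Rightarrow> nat list \<Rightarrow> bool" where
  "induces_zero_periodicity q f \<longleftrightarrow>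
    (\<forall>p \<in> fin_words_avoiding q f.
      (\<exists>w. is_first (with_prefix p (inf_words_avoiding q f)) w \<and> has_ultimate_period w [0]) \<and>
      (\<exists>w. is_last (with_prefix p (inf_words_avoiding q f)) w \<and> has_ultimate_period w [0]))"

text \<open>A left-infinite word \<open>\<cdots>a\<^sub>2a\<^sub>1a\<^sub>0\<close> is represented by the stream \<open>a\<^sub>0, a\<^sub>1, a\<^sub>2, \<dots>\<close> of its
  letters read from right to left.\<close>

definition left_inf_power :: "'a list \<Rightarrow> 'a stream" where
  "left_inf_power c = cycle (rev c)"

definition left_inf_suffix :: "'a list \<Rightarrow> 'a stream \<Rightarrow> bool" where
  "left_inf_suffix b l \<longleftrightarrow> (\<exists>l'. l = rev b @- l')"

lemma left_inf_suffix_power_iff: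
  assumes "c \<noteq> []"
  shows "left_inf_suffix b (left_inf_power c) \<longleftrightarrow> (\<exists>i. suffix b (concat (replicate i c)))"
proof -
  have cyc: "cycle (rev c) = rev (concat (replicate i c)) @- cycle (rev c)" for i
  proof (induction i)
    case (Suc i)
    have "rev (concat (replicate (Suc i) c)) @- cycle (rev c) =
        rev (concat (replicate i c)) @- rev c @- cycle (rev c)"
      by simp
    also have "rev c @- cycle (rev c) = cycle (rev c)"
      using assms by (simp add: cycle_decomp[symmetric])
    finally show ?case
      using Suc by simp
  qed simp
  show ?thesis
  proof
    assume "left_inf_suffix b (left_inf_power c)"
    then obtain l where l: "cycle (rev c) = rev b @- l"
      by (auto simp: left_inf_suffix_def left_inf_power_def)
    let ?w = "concat (replicate (length b) c)"
    have len: "length b \<le> length ?w"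
      using assms by (cases c) (auto simp: length_concat sum_list_replicate)
    have "rev b = stake (length b) (cycle (rev c))"
      by (simp add: l stake_shift)
    also have "\<dots> = take (length b) (rev ?w)"
      using len by (subst cyc[of "length b"]) (simp add: stake_shift)
    finally have "prefix (rev b) (rev ?w)"
      by (metis take_is_prefix)
    then show "\<exists>i. suffix b (concat (replicate i c))"
      by (auto simp: suffix_to_prefix)
  next
    assume "\<exists>i. suffix b (concat (replicate i c))"
    then obtain i a where "concat (replicate i c) = a @ b"
      by (auto simp: suffix_def)
    then have "cycle (rev c) = rev b @- rev a @- cycle (rev c)"
      using cyc[of i] by simp
    then show "left_inf_suffix b (left_inf_power c)"
      by (auto simp: left_inf_suffix_def left_inf_power_def)
  qed
qed

definition V :: "nat list set" where
  "V = (\<Union>m. {b @ [0] | b. left_inf_suffix b (left_inf_power (1 # replicate m 0))})"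

end

theory Submission
  imports Defs
begin

text \<open>Appending \<open>0\<close> or \<open>1\<close> preserves the parity that orients the Gray order, appending \<open>q - 1\<close>
  reverses it, and a nonzero letter never completes \<open>f\<close>. Hence one extreme word with prefix \<open>p\<close> is
  \<open>p\<close> continued greedily by the letters \<open>0\<close>, or \<open>1\<close> whenever \<open>0\<close> would complete \<open>f\<close>, and the
  other one is the greedy continuation of \<open>p\<close> followed by \<open>q - 1\<close>. So \<open>f = b0\<close> induces zero
  periodicity iff the greedy continuation never meets \<open>b\<close> infinitely often. Between two
  consecutive meetings it reads \<open>10\<^sup>m\<close>, where \<open>m\<close> is the number of trailing zeros of \<open>b\<close> unless
  \<open>b\<close> consists of zeros, so infinitely many meetings force \<open>b\<close> to be a suffix of a power of
  \<open>10\<^sup>m\<close>. Conversely, if \<open>b\<close> is such a suffix, then so is \<open>b10\<^sup>m\<close>, and the greedy continuation of \<open>b\<close>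
  meets \<open>b\<close> again and again.\<close>

subsection \<open>The Gray order\<close>

text \<open>This is \<open>u + v\<close> of the Gray order, accumulated letter by letter. A letter
  changes its parity exactly when it is nonzero and even.\<close>

definition gray_weight :: "nat list \<Rightarrow> nat" where
  "gray_weight p = (\<Sum>c\<leftarrow>p. c + of_bool (c \<noteq> 0))"

lemma gray_weight_simps [simp]:
  "gray_weight [] = 0"
  "gray_weight (c # p) = c + of_bool (c \<noteq> 0) + gray_weight p"
  "gray_weight (p @ r) = gray_weight p + gray_weight r"
  by (simp_all add: gray_weight_def)

lemma even_gray_weight_binary: "set p \<subseteq> {0, 1} \<Longrightarrow> even (gray_weight p)"
  by (induction p) auto

lemma gray_weight_stake:
  "(\<Sum>i<k. s !! i) + card {i. i < k \<and> s !! i \<noteq> 0} = gray_weight (stake k s)"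
proof (induction k)
  case (Suc k)
  have "{i. i < Suc k \<and> s !! i \<noteq> 0} =
      (if s !! k = 0 then {i. i < k \<and> s !! i \<noteq> 0} else insert k {i. i < k \<and> s !! i \<noteq> 0})"
    by (auto simp: less_Suc_eq)
  with Suc show ?case
    by (simp add: stake_Suc del: stake.simps(2))
qed simp

lemma stream_eq_snth_iff: "s = t \<longleftrightarrow> (\<forall>n. s !! n = t !! n)"
  using smap_alt[of id s t] by (simp add: stream.map_id)

lemma stake_eq_iff: "stake k s = stake k t \<longleftrightarrow> (\<forall>i<k. s !! i = t !! i)"
  by (simp add: list_eq_iff_nth_eq)

lemma gray_less_iff:
  "s \<lhd>\<^sub>G t \<longleftrightarrow> (\<exists>k. stake k s = stake k t \<and>
     (if even (gray_weight (stake k s)) then s !! k < t !! k else t !! k < s !! k))"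
  unfolding gray_less_def Let_def gray_weight_stake stake_eq_iff by (intro ex_cong1) auto

lemma gray_less_asym: "s \<lhd>\<^sub>G t \<Longrightarrow> \<not> t \<lhd>\<^sub>G s"
proof
  assume "s \<lhd>\<^sub>G t" "t \<lhd>\<^sub>G s"
  then obtain k l
    where k: "stake k s = stake k t"
      "if even (gray_weight (stake k s)) then s !! k < t !! k else t !! k < s !! k"
    and l: "stake l t = stake l s"
      "if even (gray_weight (stake l t)) then t !! l < s !! l else s !! l < t !! l"
    unfolding gray_less_iff by blast
  \<comment> \<open>Each witness is a disagreement preceded only by agreements, so neither can lie
    before the other.\<close>
  have "k = l"
    using k l by (metis nat_neq_iff stake_eq_iff)
  with k l show False
    by (auto split: if_splits)
qed

lemma is_first_unique: "is_first X v \<Longrightarrow> is_first X w \<Longrightarrow> v = w"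
  unfolding is_first_def by (metis gray_less_asym)

lemma is_last_unique: "is_last X v \<Longrightarrow> is_last X w \<Longrightarrow> v = w"
  unfolding is_last_def by (metis gray_less_asym)

lemma first_difference:
  fixes s t :: "'a stream"
  assumes "s \<noteq> t"
  obtains k where "stake k s = stake k t" "s !! k \<noteq> t !! k"
proof -
  let ?k = "LEAST k. s !! k \<noteq> t !! k"
  have "\<exists>k. s !! k \<noteq> t !! k"
    using assms by (auto simp: stream_eq_snth_iff)
  then have "s !! ?k \<noteq> t !! ?k"
    by (rule LeastI_ex)
  moreover have "stake ?k s = stake ?k t"
    unfolding stake_eq_iff using not_less_Least by blast
  ultimately show thesis
    using that by blast
qed

subsection \<open>Factors and ultimate periods\<close>

lemma stream_factor_iff: "stream_factor f w \<longleftrightarrow> (\<exists>n. sublist f (stake n w))"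
proof
  assume "stream_factor f w"
  then obtain b w' where "w = b @- f @- w'"
    unfolding stream_factor_def by blast
  then have "stake (length b + length f) w = b @ f"
    by (simp add: stake_shift)
  then show "\<exists>n. sublist f (stake n w)"
    by (metis sublist_append_leftI sublist_order.order_refl)
next
  assume "\<exists>n. sublist f (stake n w)"
  then obtain n a b where "stake n w = a @ f @ b"
    unfolding sublist_def by blast
  then have "w = a @- f @- b @- sdrop n w"
    by (metis shift_append stake_sdrop)
  then show "stream_factor f w"
    unfolding stream_factor_def by blast
qed

lemma with_prefix_iff: "w \<in> with_prefix p X \<longleftrightarrow> w \<in> X \<and> stake (length p) w = p"
  unfolding with_prefix_def
  using stake_sdrop[of "length p" w, symmetric] by (auto simp: stake_shift)

lemma zero_ultimate_period_iff:
  "has_ultimate_period w [0 :: nat] \<longleftrightarrow> (\<exists>N. \<forall>n\<ge>N. w !! n = 0)"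
proof
  have cyc: "cycle [0 :: nat] !! n = 0" for n
    by (simp flip: sconst_cycle)
  show "\<exists>N. \<forall>n\<ge>N. w !! n = 0" if "has_ultimate_period w [0]"
    using that cyc unfolding has_ultimate_period_def by (metis shift_snth_ge)
  show "has_ultimate_period w [0]" if zeros: "\<exists>N. \<forall>n\<ge>N. w !! n = 0"
  proof -
    obtain N where "\<forall>n\<ge>N. w !! n = 0"
      using zeros by blast
    then have "sdrop N w = cycle [0]"
      using cyc by (simp add: stream_eq_snth_iff sdrop_snth)
    then show ?thesis
      unfolding has_ultimate_period_def by (metis stake_sdrop list.distinct(1))
  qed
qed

subsection \<open>The greedy continuation\<close>

text \<open>The second argument carries the whole word written so far, since an occurrence of
  \<open>f\<close> may begin inside the original prefix.\<close>

primcorec greedy :: "nat list \<Rightarrow> nat list \<Rightarrow> nat stream" where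
  "greedy f p = (let c = if suffix f (p @ [0]) then 1 else 0 in c ## greedy f (p @ [c]))"

lemma greedy_snth:
  "greedy f p !! n = (if suffix f (p @ stake n (greedy f p) @ [0]) then 1 else 0)"
proof (induction n arbitrary: p)
  case (Suc n)
  let ?c = "if suffix f (p @ [0]) then 1 else 0 :: nat"
  have "greedy f p = ?c ## greedy f (p @ [?c])"
    by (subst greedy.code) (simp add: Let_def)
  then show ?case
    using Suc[of "p @ [?c]"] by simp
qed simp

definition greedy_word :: "nat list \<Rightarrow> nat list \<Rightarrow> nat stream" where
  "greedy_word f p = p @- greedy f p"

lemma stake_length_greedy_word [simp]: "stake (length p) (greedy_word f p) = p"
  by (simp add: greedy_word_def stake_shift)

lemma greedy_word_snth:
  assumes "length p \<le> n"
  shows "greedy_word f p !! n = (if suffix f (stake n (greedy_word f p) @ [0]) then 1 else 0)"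
  using assms greedy_snth[of f p "n - length p"] by (simp add: greedy_word_def stake_shift)

lemma stake_greedy_word_Suc:
  assumes "length p \<le> n"
  shows "stake (Suc n) (greedy_word f p) = stake n (greedy_word f p) @
    [if suffix f (stake n (greedy_word f p) @ [0]) then 1 else 0]"
  using greedy_word_snth[OF assms] by (simp add: stake_Suc del: stake.simps(2))

text \<open>A growing prefix can acquire \<open>f\<close> only at its end. A written
  \<open>1\<close> cannot end it because \<open>f\<close> ends in \<open>0\<close>, and
  \<open>0\<close> is written only where it does not complete \<open>f\<close>.\<close>

lemma greedy_word_avoids:
  assumes "p \<in> fin_words_avoiding q f" "f \<noteq> []" "last f = 0" "q \<ge> 2"
  shows "greedy_word f p \<in> with_prefix p (inf_words_avoiding q f)"
proof -
  let ?w = "greedy_word f p"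
  have *: "stake n ?w \<in> fin_words_avoiding q f" if "length p \<le> n" for n
    using that
  proof (induction n rule: dec_induct)
    case base
    then show ?case
      using assms by simp
  next
    case (step n)
    have "\<not> suffix f (r @ [1])" for r
      using assms by (metis last_appendR suffix_def last_snoc zero_neq_one)
    then show ?case
      using step assms unfolding stake_greedy_word_Suc[OF step(1)]
      by (auto simp: fin_words_avoiding_def alphabet_def dest!: sublist_snoc[THEN iffD1])
  qed
  have "?w !! n < q" for n
    using assms greedy_word_snth[of p n f]
    by (cases "length p \<le> n")
       (auto simp: fin_words_avoiding_def alphabet_def greedy_word_def)
  moreover have "\<not> sublist f (stake n ?w)" for n
  proof -
    \<comment> \<open>Lengthening the prefix to at least \<open>length p\<close> brings it into the
      range of the induction above.\<close>
    have "sublist (stake n ?w) (stake (n + length p) ?w)"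
      by (metis stake_add sublist_append_rightI)
    moreover have "\<not> sublist f (stake (n + length p) ?w)"
      using *[of "n + length p"] by (simp add: fin_words_avoiding_def)
    ultimately show ?thesis
      using sublist_order.order_trans by blast
  qed
  ultimately show ?thesis
    by (auto simp: with_prefix_iff inf_words_avoiding_def stream_factor_iff streams_iff_sset
        sset_range alphabet_def)
qed

text \<open>The first disagreement lies beyond \<open>p\<close>. There the greedy letter is either
  \<open>0\<close>, or \<open>1\<close> at a place where \<open>0\<close> would make
  \<open>x\<close> contain \<open>f\<close>.\<close>

lemma greedy_word_least:
  assumes "x \<in> with_prefix p (inf_words_avoiding q f)" "x \<noteq> greedy_word f p"
  obtains k where "stake k (greedy_word f p) = stake k x" "greedy_word f p !! k < x !! k"
    "even (gray_weight (stake k x)) \<longleftrightarrow> even (gray_weight p)"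
proof -
  let ?w = "greedy_word f p"
  obtain k where k: "stake k ?w = stake k x" "?w !! k \<noteq> x !! k"
    using first_difference assms(2) by metis
  have len: "length p \<le> k"
  proof (rule ccontr)
    assume "\<not> length p \<le> k"
    moreover have "stake (length p) x = stake (length p) ?w"
      using assms(1) by (simp add: with_prefix_iff)
    ultimately show False
      using k(2) unfolding stake_eq_iff by auto
  qed
  have "?w !! k < x !! k"
  proof (cases "suffix f (stake k ?w @ [0])")
    case True
    have "x !! k \<noteq> 0"
    proof
      assume "x !! k = 0"
      then have "suffix f (stake (Suc k) x)"
        using True k by (simp add: stake_Suc del: stake.simps(2))
      then show False
        using assms(1) suffix_imp_sublist[of f "stake (Suc k) x"]
        unfolding with_prefix_iff inf_words_avoiding_def stream_factor_iff by blast
    qed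
    then show ?thesis
      using k(2) True by (simp only: greedy_word_snth[OF len] if_True)
  next
    case False
    then show ?thesis
      using k(2) False by (simp only: greedy_word_snth[OF len] if_False)
  qed
  \<comment> \<open>Between \<open>p\<close> and position \<open>k\<close> only \<open>0\<close> and
    \<open>1\<close> occur, of weights 0 and 2, so the parity is still that of
    \<open>p\<close>.\<close>
  moreover have "stake k ?w = p @ stake (k - length p) (greedy f p)"
    using len by (simp add: greedy_word_def stake_shift)
  moreover have "greedy f p !! i \<in> {0, 1}" for i
    by (subst greedy_snth) simp
  then have "set (stake n (greedy f p)) \<subseteq> {0, 1}" for n
    by (metis in_set_conv_nth length_stake stake_nth subsetI)
  then have "even (gray_weight (stake n (greedy f p)))" for n
    by (rule even_gray_weight_binary)
  ultimately show thesis
    using k that by (metis even_add gray_weight_simps(3))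
qed

section \<open>The two extreme words with a given prefix\<close>

context
  fixes q f p
  assumes p: "p \<in> fin_words_avoiding q f" and f: "f \<noteq> []" "last f = 0" and q: "q \<ge> 2"
begin

lemma is_first_greedy_word:
  assumes "even (gray_weight p)"
  shows "is_first (with_prefix p (inf_words_avoiding q f)) (greedy_word f p)"
  unfolding is_first_def
proof (intro conjI ballI impI)
  fix x
  assume "x \<in> with_prefix p (inf_words_avoiding q f)" "x \<noteq> greedy_word f p"
  then obtain k where "stake k (greedy_word f p) = stake k x" "greedy_word f p !! k < x !! k"
    "even (gray_weight (stake k x)) \<longleftrightarrow> even (gray_weight p)"
    by (rule greedy_word_least)
  then show "greedy_word f p \<lhd>\<^sub>G x"
    unfolding gray_less_iff using assms by (intro exI[of _ k]) simp
qed (rule greedy_word_avoids[OF p f q])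

text \<open>Odd parity reverses the comparison at the first disagreement, so the lexicographically
  least word comes last.\<close>

lemma is_last_greedy_word:
  assumes "odd (gray_weight p)"
  shows "is_last (with_prefix p (inf_words_avoiding q f)) (greedy_word f p)"
  unfolding is_last_def
proof (intro conjI ballI impI)
  fix x
  assume "x \<in> with_prefix p (inf_words_avoiding q f)" "x \<noteq> greedy_word f p"
  then obtain k where "stake k (greedy_word f p) = stake k x" "greedy_word f p !! k < x !! k"
    "even (gray_weight (stake k x)) \<longleftrightarrow> even (gray_weight p)"
    by (rule greedy_word_least)
  then show "x \<lhd>\<^sub>G greedy_word f p"
    unfolding gray_less_iff using assms by (intro exI[of _ k]) simp
qed (rule greedy_word_avoids[OF p f q])

end

context
  fixes q f p
  assumes p: "p \<in> fin_words_avoiding q f" and f: "f \<noteq> []" "last f = 0" and q: "q \<ge> 3" "odd q"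
begin

lemma snoc_top_avoids: "p @ [q - 1] \<in> fin_words_avoiding q f"
proof -
  have top_nonzero: "q - 1 \<noteq> 0"
    using q by simp
  have "\<not> suffix f (p @ [q - 1])"
    using f q by (metis last_appendR suffix_def last_snoc top_nonzero)
  then show ?thesis
    using p q by (auto simp: fin_words_avoiding_def alphabet_def dest!: sublist_snoc[THEN iffD1])
qed

lemma greedy_word_snoc_top_avoids:
  "greedy_word f (p @ [q - 1]) \<in> with_prefix p (inf_words_avoiding q f)"
proof -
  have "greedy_word f (p @ [q - 1]) \<in> with_prefix (p @ [q - 1]) (inf_words_avoiding q f)"
    using greedy_word_avoids[OF snoc_top_avoids f] q by simp
  then show ?thesis
    by (auto simp: with_prefix_def)
qed

text \<open>Splits the competitors: those that continue \<open>p\<close> by \<open>q - 1\<close>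
  fall under the longer prefix, the others are decided at that very letter.\<close>

lemma greedy_word_snoc_top_cases:
  assumes "x \<in> with_prefix p (inf_words_avoiding q f)"
  shows "x \<in> with_prefix (p @ [q - 1]) (inf_words_avoiding q f) \<or>
    stake (length p) x = stake (length p) (greedy_word f (p @ [q - 1])) \<and>
    x !! length p < greedy_word f (p @ [q - 1]) !! length p"
proof -
  have *: "stake (length p) x = p" "x !! length p < q"
    using assms by (auto simp: with_prefix_iff inf_words_avoiding_def streams_iff_snth alphabet_def)
  have "stake (length p) (greedy_word f (p @ [q - 1])) = p"
    "greedy_word f (p @ [q - 1]) !! length p = q - 1"
    by (simp_all add: greedy_word_def stake_shift)
  moreover have "stake (length (p @ [q - 1])) x = p @ [x !! length p]"
    using * by (simp add: stake_Suc del: stake.simps(2))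
  ultimately show ?thesis
    using assms * q unfolding with_prefix_iff by auto
qed

text \<open>The nonzero letter \<open>q - 1\<close> has weight \<open>q\<close>, which is
  odd.\<close>

lemma parity_snoc_top: "even (gray_weight (p @ [q - 1])) \<longleftrightarrow> odd (gray_weight p)"
  using q by auto

text \<open>With odd parity the largest letter comes first after \<open>p\<close>. Appending it
  makes the parity even, so the greedy continuation is first among the words that share it.\<close>

lemma is_first_greedy_word_snoc_top:
  assumes "odd (gray_weight p)"
  shows "is_first (with_prefix p (inf_words_avoiding q f)) (greedy_word f (p @ [q - 1]))"
  unfolding is_first_def
proof (intro conjI ballI impI)
  fix x
  assume x: "x \<in> with_prefix p (inf_words_avoiding q f)" "x \<noteq> greedy_word f (p @ [q - 1])"
  have "is_first (with_prefix (p @ [q - 1]) (inf_words_avoiding q f)) (greedy_word f (p @ [q - 1]))"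
    using is_first_greedy_word[OF snoc_top_avoids f] q assms parity_snoc_top by simp
  then show "greedy_word f (p @ [q - 1]) \<lhd>\<^sub>G x"
    using greedy_word_snoc_top_cases[OF x(1)]
  proof (elim disjE)
    assume "stake (length p) x = stake (length p) (greedy_word f (p @ [q - 1])) \<and>
      x !! length p < greedy_word f (p @ [q - 1]) !! length p"
    moreover have "stake (length p) x = p"
      using x(1) by (simp add: with_prefix_iff)
    ultimately show ?thesis
      unfolding gray_less_iff using assms by (intro exI[of _ "length p"]) auto
  qed (use x(2) in \<open>auto simp: is_first_def\<close>)
qed (rule greedy_word_snoc_top_avoids)

lemma is_last_greedy_word_snoc_top:
  assumes "even (gray_weight p)"
  shows "is_last (with_prefix p (inf_words_avoiding q f)) (greedy_word f (p @ [q - 1]))"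
  unfolding is_last_def
proof (intro conjI ballI impI)
  fix x
  assume x: "x \<in> with_prefix p (inf_words_avoiding q f)" "x \<noteq> greedy_word f (p @ [q - 1])"
  have "is_last (with_prefix (p @ [q - 1]) (inf_words_avoiding q f)) (greedy_word f (p @ [q - 1]))"
    using is_last_greedy_word[OF snoc_top_avoids f] q assms parity_snoc_top by simp
  then show "x \<lhd>\<^sub>G greedy_word f (p @ [q - 1])"
    using greedy_word_snoc_top_cases[OF x(1)]
  proof (elim disjE)
    assume "stake (length p) x = stake (length p) (greedy_word f (p @ [q - 1])) \<and>
      x !! length p < greedy_word f (p @ [q - 1]) !! length p"
    moreover have "stake (length p) x = p"
      using x(1) by (simp add: with_prefix_iff)
    ultimately show ?thesis
      unfolding gray_less_iff using assms by (intro exI[of _ "length p"]) auto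
  qed (use x(2) in \<open>auto simp: is_last_def\<close>)
qed (rule greedy_word_snoc_top_avoids)

end

text \<open>One extreme is the greedy word of \<open>p\<close>, the other that of
  \<open>p @ [q - 1]\<close>; as \<open>p\<close> is arbitrary, the second prefix is covered as
  well. Uniqueness of extremes gives the converse.\<close>

lemma induces_zero_periodicity_iff:
  assumes "q \<ge> 3" "odd q" "f \<noteq> []" "last f = 0"
  shows "induces_zero_periodicity q f \<longleftrightarrow>
    (\<forall>p \<in> fin_words_avoiding q f. has_ultimate_period (greedy_word f p) [0])"
proof (intro iffI ballI)
  have q: "q \<ge> 2"
    using assms by simp
  fix p
  assume zp: "induces_zero_periodicity q f" and p: "p \<in> fin_words_avoiding q f"
  show "has_ultimate_period (greedy_word f p) [0]"
  proof (cases "even (gray_weight p)")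
    case True
    then show ?thesis
      using zp p is_first_greedy_word[OF p assms(3,4) q] is_first_unique
      unfolding induces_zero_periodicity_def by metis
  next
    case False
    then show ?thesis
      using zp p is_last_greedy_word[OF p assms(3,4) q] is_last_unique
      unfolding induces_zero_periodicity_def by metis
  qed
next
  have q: "q \<ge> 2"
    using assms by simp
  assume period: "\<forall>p \<in> fin_words_avoiding q f. has_ultimate_period (greedy_word f p) [0]"
  show "induces_zero_periodicity q f"
    unfolding induces_zero_periodicity_def
  proof
    fix p
    assume p: "p \<in> fin_words_avoiding q f"
    note top = snoc_top_avoids[OF p assms(3,4,1,2)]
    show "(\<exists>w. is_first (with_prefix p (inf_words_avoiding q f)) w \<and> has_ultimate_period w [0]) \<and>
      (\<exists>w. is_last (with_prefix p (inf_words_avoiding q f)) w \<and> has_ultimate_period w [0])"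
    proof (cases "even (gray_weight p)")
      case True
      then show ?thesis
        using period p top is_first_greedy_word[OF p assms(3,4) q]
          is_last_greedy_word_snoc_top[OF p assms(3,4,1,2)] by blast
    next
      case False
      then show ?thesis
        using period p top is_last_greedy_word[OF p assms(3,4) q]
          is_first_greedy_word_snoc_top[OF p assms(3,4,1,2)] by blast
    qed
  qed
qed

subsection \<open>Recurring blocked positions\<close>

lemma V_iff: "f \<in> V \<longleftrightarrow> (\<exists>b m i. f = b @ [0] \<and> suffix b (concat (replicate i (1 # replicate m 0))))"
  by (auto simp: V_def left_inf_suffix_power_iff)

lemma concat_replicate_snoc: "concat (replicate (Suc i) c) = concat (replicate i c) @ c"
  by (induction i) simp_all

lemma greedy_word_zeros:
  assumes "length p \<le> n"
    and "\<And>k. n \<le> k \<Longrightarrow> k < n + t \<Longrightarrow> \<not> suffix f (stake k (greedy_word f p) @ [0])"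
  shows "stake (n + t) (greedy_word f p) = stake n (greedy_word f p) @ replicate t 0"
  using assms(2)
proof (induction t)
  case (Suc t)
  have "stake (n + t) (greedy_word f p) = stake n (greedy_word f p) @ replicate t 0"
    using Suc by simp
  moreover have "stake (Suc (n + t)) (greedy_word f p) = stake (n + t) (greedy_word f p) @ [0]"
    unfolding stake_greedy_word_Suc[OF trans_le_add1[OF assms(1)]] using Suc.prems[of "n + t"] by simp
  ultimately show ?case
    by (simp add: replicate_append_same del: stake.simps(2))
qed simp

lemma nonzero_zeros_suffix_unique:
  assumes "c \<noteq> 0" "d \<noteq> 0" "a @ c # replicate j (0 :: nat) = b @ d # replicate t 0"
  shows "j = t"
proof -
  \<comment> \<open>Reading from the right, the initial run of zeros recovers the exponent on each
    side.\<close>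
  have "takeWhile (\<lambda>x. x = 0) (rev (a @ c # replicate j 0)) = replicate j 0"
    "takeWhile (\<lambda>x. x = 0) (rev (b @ d # replicate t 0)) = replicate t 0"
    using assms(1,2) by (simp_all add: takeWhile_append)
  then show ?thesis
    using assms(3) by (metis length_replicate)
qed

lemma trailing_zeros:
  fixes b :: "nat list"
  shows "(\<exists>j. b = replicate j 0) \<or> (\<exists>a c j. c \<noteq> 0 \<and> b = a @ c # replicate j 0)"
proof (induction b rule: rev_induct)
  case Nil
  then show ?case
    by (metis replicate_0)
next
  case (snoc x b)
  show ?case
  proof (cases "x = 0")
    case True
    have "replicate j 0 @ [x] = replicate (Suc j) 0" for j
      using True by (simp add: replicate_append_same)
    then show ?thesis
      using snoc by (metis append_Cons append_assoc)
  next
    case False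
    then show ?thesis
      by (metis replicate_0)
  qed
qed

lemma not_zero_period_imp_V:
  assumes "f \<noteq> []" "last f = 0" "\<not> has_ultimate_period (greedy_word f p) [0]"
  shows "f \<in> V"
proof -
  define b where "b = butlast f"
  have f: "f = b @ [0]"
    using assms by (metis append_butlast_last_id b_def)
  let ?W = "\<lambda>n. stake n (greedy_word f p)"
  have later: "\<exists>k\<ge>n. length p \<le> k \<and> suffix b (?W k)" for n
  proof -
    \<comment> \<open>A nonzero letter beyond \<open>p\<close> shows that \<open>0\<close> was
      blocked there, so the word before it ends in \<open>b\<close>.\<close>
    obtain k where "k \<ge> max n (length p)" "greedy_word f p !! k \<noteq> 0"
      using assms(3) unfolding zero_ultimate_period_iff by blast
    then show ?thesis
      using greedy_word_snth[of p k f] by (auto simp: f split: if_splits)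
  qed
  consider j where "b = replicate j 0" | a c j where "c \<noteq> 0" "b = a @ c # replicate j 0"
    using trailing_zeros by blast
  then show ?thesis
  proof cases
    case 1
    \<comment> \<open>A word of \<open>j\<close> zeros is already a suffix of one block with
      \<open>m = j\<close>.\<close>
    then have "suffix b (concat (replicate 1 (1 # replicate j 0)))"
      by (simp add: suffix_Cons)
    then show ?thesis
      unfolding V_iff f by blast
  next
    case 2
    let ?c = "1 # replicate j 0 :: nat list"
    \<comment> \<open>Keeping \<open>n\<close> blocked in the induction lets the next block be
      attached at the next blocked position.\<close>
    have "\<exists>n\<ge>length p. suffix b (?W n) \<and> suffix (concat (replicate i ?c)) (?W n)" for i
    proof (induction i)
      case 0
      then show ?case
        using later[of 0] by auto
    next
      case (Suc i)
      then obtain n where n: "length p \<le> n" "suffix b (?W n)"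
        "suffix (concat (replicate i ?c)) (?W n)"
        by blast
      \<comment> \<open>The next blocked position after \<open>n\<close>; in between the word reads
        a \<open>1\<close> followed only by zeros.\<close>
      define k where "k = (LEAST k. Suc n \<le> k \<and> suffix b (?W k))"
      have k: "Suc n \<le> k" "suffix b (?W k)"
        using LeastI_ex[of "\<lambda>k. Suc n \<le> k \<and> suffix b (?W k)"] later[of "Suc n"]
        unfolding k_def by blast+
      have "\<not> suffix b (?W l)" if "Suc n \<le> l" "l < k" for l
        using not_less_Least[of l "\<lambda>k. Suc n \<le> k \<and> suffix b (?W k)"] that unfolding k_def by blast
      then have "?W k = ?W (Suc n) @ replicate (k - Suc n) 0"
        using greedy_word_zeros[of p "Suc n" "k - Suc n" f] n k by (simp add: f del: stake.simps(2))
      then have W: "?W k = ?W n @ 1 # replicate (k - Suc n) 0"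
        using n stake_greedy_word_Suc[of p n f] by (simp add: f del: stake.simps(2))
      \<comment> \<open>Since \<open>b\<close> ends in a nonzero \<open>c\<close> and
        \<open>j\<close> zeros, the run of zeros after the written \<open>1\<close> has length
        \<open>j\<close>.\<close>
      have "k - Suc n = j"
        using k(2) 2 nonzero_zeros_suffix_unique[of c 1] unfolding W suffix_def
        by (metis append_assoc zero_neq_one)
      then have "?W k = ?W n @ ?c"
        using W by simp
      then have "suffix (concat (replicate (Suc i) ?c)) (?W k)"
        using n(3) unfolding concat_replicate_snoc by simp
      then show ?case
        using k n by (intro exI[of _ k]) simp
    qed
    then obtain n where "suffix b (?W n)" "suffix (concat (replicate (length b) ?c)) (?W n)"
      by blast
    \<comment> \<open>Every block is nonempty, so \<open>length b\<close> blocks are long enough;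
      two suffixes of one word are nested by length.\<close>
    moreover have "length b \<le> length (concat (replicate (length b) ?c))"
      by (simp add: length_concat sum_list_replicate)
    ultimately have "suffix b (concat (replicate (length b) ?c))"
      using suffix_length_suffix by blast
    then show ?thesis
      unfolding V_iff f by blast
  qed
qed

text \<open>Both words are suffixes of the next power of \<open>c\<close>, and the shorter of two
  such suffixes is a suffix of the longer.\<close>

lemma suffix_snoc_block:
  assumes "suffix b (concat (replicate i c))"
  shows "suffix b (b @ c)"
proof -
  have "suffix (b @ c) (concat (replicate (Suc i) c))"
    using assms unfolding concat_replicate_snoc by simp
  moreover have "suffix b (concat (replicate (Suc i) c))"
    using assms by (simp add: suffix_appendI)
  ultimately show ?thesis
    using suffix_length_suffix by (metis length_append le_add1)
qed

lemma V_imp_not_zero_period: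
  assumes "suffix b (concat (replicate i (1 # replicate m 0)))"
  shows "\<not> has_ultimate_period (greedy_word (b @ [0]) b) [0]"
proof -
  let ?w = "greedy_word (b @ [0]) b"
  let ?blocked = "\<lambda>n. length b \<le> n \<and> suffix b (stake n ?w)"
  have later: "\<exists>k>n. ?blocked k" if n: "?blocked n" for n
  proof (rule ccontr)
    assume "\<not> (\<exists>k>n. ?blocked k)"
    then have none: "\<not> suffix b (stake k ?w)" if "Suc n \<le> k" for k
      using that n by (metis Suc_le_eq le_trans less_imp_le_nat)
    \<comment> \<open>Without a later blocked position, the \<open>1\<close> written at
      \<open>n\<close> is followed by at least \<open>m\<close> zeros, after which \<open>b\<close>
      is a suffix again. The contradiction avoids locating the next blocked position, which may come
      sooner, as when \<open>b\<close> has fewer than \<open>m\<close> letters, all zero.\<close>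
    have "stake (Suc n + m) ?w = stake n ?w @ 1 # replicate m 0"
      using n none greedy_word_zeros[of b "Suc n" m "b @ [0]"] stake_greedy_word_Suc[of b n "b @ [0]"]
      by (simp del: stake.simps(2))
    moreover have "suffix b (stake n ?w @ 1 # replicate m 0)"
      using n suffix_snoc_block[OF assms] by (metis suffix_order.order_trans same_suffix_suffix)
    ultimately show False
      using none[of "Suc n + m"] by simp
  qed
  have "\<exists>n\<ge>N. ?blocked n" for N
  proof (induction N)
    case 0
    \<comment> \<open>The starting prefix \<open>b\<close> is itself blocked.\<close>
    then show ?case
      by (intro exI[of _ "length b"]) simp
  next
    case (Suc N)
    then show ?case
      using later by (meson Suc_leI le_less_trans)
  qed
  then show ?thesis
    unfolding zero_ultimate_period_iff using greedy_word_snth[of b _ "b @ [0]"]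
    by (metis snoc_suffix_snoc zero_neq_one)
qed

theorem theorem2:
  fixes q :: nat and f :: "nat list"
  assumes "q \<ge> 3" and "odd q"
    and "f \<in> lists (alphabet q)" and "f \<noteq> []" and "last f = 0"
  shows "\<not> induces_zero_periodicity q f \<longleftrightarrow> f \<in> V"
proof
  assume "\<not> induces_zero_periodicity q f"
  then show "f \<in> V"
    using not_zero_period_imp_V[OF assms(4,5)] induces_zero_periodicity_iff[OF assms(1,2,4,5)] by blast
next
  assume "f \<in> V"
  then obtain b m i where b: "f = b @ [0]" "suffix b (concat (replicate i (1 # replicate m 0)))"
    unfolding V_iff by blast
  \<comment> \<open>Being shorter than \<open>f\<close>, the word \<open>b\<close> is an admissible
    prefix.\<close>
  have "b \<in> fin_words_avoiding q f"
    using assms(3) b(1) by (auto simp: fin_words_avoiding_def dest: sublist_length_le)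
  then show "\<not> induces_zero_periodicity q f"
    using V_imp_not_zero_period[OF b(2)] b(1) induces_zero_periodicity_iff[OF assms(1,2,4,5)] by blast
qed

end
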